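(* Let $N\ge2$ and assume the $N$ vortices have the same winding number, i.e. $m_1=\dots=m_N=\pm1$. If there exist a unit vector $\mathbf e\in\mathbb R^2$, $\mathbf x^0\in\mathbb R^2$ and $0\le\theta_0<2\pi$ such that $\mathbf X^0\in S_{\mathbf e}^N(\mathbf x^0,\theta_0)$, then the solution $\mathbf X(t)=(\mathbf x_1(t),\dots,\mathbf x_N(t))$ of $$\dot{\mathbf x}_j(t)=2m_j\sum_{k=1,k\ne j}^N m_k\frac{\mathbf x_j(t)-\mathbf x_k(t)}{|\mathbf x_j(t)-\mathbf x_k(t)|^2},\qquad 1\le j\le N,\qquad \mathbf X(0)=\mathbf X^0,$$ satisfies $\mathbf X(t)\in S_{\mathbf e}^N(\mathbf x^0,\theta_0)$ for all $t\ge0$.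
   Context: $Q(\theta)=\begin{pmatrix}\cos\theta&-\sin\theta\\ \sin\theta&\cos\theta\end{pmatrix}$. With $\theta_N^j=\frac{2(j-1)\pi}{N}$ and $\mathbf x_j^{(0)}=Q(\theta_N^j+\theta_0)\mathbf e$ for $1\le j\le N$, $S_{\mathbf e}^N(\mathbf x^0,\theta_0):=\{(\mathbf x^0+r\mathbf x_1^{(0)},\dots,\mathbf x^0+r\mathbf x_N^{(0)}) : r>0\}\subset\mathbb R^{2\times N}$ (regular $N$-gons centered at $\mathbf x^0$ with fixed orientation). *)

theory Defs
  imports "HOL-Analysis.Analysis"
begin

definition Q :: "real \<Rightarrow> real^2^2" where
  "Q \<theta> = vector [vector [cos \<theta>, - sin \<theta>],
                  vector [sin \<theta>,   cos \<theta>]]"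

definition polygon_angle :: "nat \<Rightarrow> nat \<Rightarrow> real" where
  "polygon_angle N j = 2 * (real j - 1) * pi / real N"

definition polygon_vertex :: "nat \<Rightarrow> real^2 \<Rightarrow> real \<Rightarrow> nat \<Rightarrow> real^2" where
  "polygon_vertex N e \<theta>0 j = Q (polygon_angle N j + \<theta>0) *v e"

text \<open>
  A configuration of \<open>N\<close> points of the plane is a function \<open>nat \<Rightarrow> real^2\<close> of which only
  the values at the indices \<open>1, \<dots>, N\<close> are significant; the values elsewhere are
  unconstrained in all the definitions below.
\<close>

definition regular_polygons ::
    "nat \<Rightarrow> real^2 \<Rightarrow> real^2 \<Rightarrow> real \<Rightarrow> (nat \<Rightarrow> real^2) set" where
  "regular_polygons N e x0 \<theta>0 =
     {X. \<exists>r>0. \<forall>j\<in>{1..N}. X j = x0 + r *\<^sub>R polygon_vertex N e \<theta>0 j}"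

definition vortex_velocity ::
    "nat \<Rightarrow> (nat \<Rightarrow> int) \<Rightarrow> (nat \<Rightarrow> real^2) \<Rightarrow> nat \<Rightarrow> real^2" where
  "vortex_velocity N m X j =
     (2 * real_of_int (m j)) *\<^sub>R
       (\<Sum>k\<in>{1..N} - {j}. real_of_int (m k) *\<^sub>R ((X j - X k) /\<^sub>R (norm (X j - X k))\<^sup>2))"

text \<open>
  Solutions are classical and global forward in time, with a one-sided derivative at \<open>t = 0\<close>.
  Since \<open>x / 0 = 0\<close> in HOL, the absence of collisions, without which the right-hand side of
  the equation is undefined, has to be required explicitly.
\<close>

definition vortex_solution ::
    "nat \<Rightarrow> (nat \<Rightarrow> int) \<Rightarrow> (nat \<Rightarrow> real^2) \<Rightarrow> (real \<Rightarrow> nat \<Rightarrow> real^2) \<Rightarrow> bool" where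
  "vortex_solution N m X0 X \<longleftrightarrow>
     (\<forall>j\<in>{1..N}. X 0 j = X0 j) \<and>
     (\<forall>t\<ge>0. inj_on (X t) {1..N}) \<and>
     (\<forall>t\<ge>0. \<forall>j\<in>{1..N}.
        ((\<lambda>s. X s j) has_vector_derivative vortex_velocity N m (X t) j) (at t within {0..}))"

end

theory Submission
  imports Defs
begin

text \<open>
  In the frame of a vertex \<open>v\<close> of the unit polygon, the vertex at relative angle \<open>\<delta>\<close>
  contributes \<open>v - (sin \<delta> / (1 - cos \<delta>)) v\<^sup>\<bottom>\<close> to the velocity of \<open>v\<close>, where \<open>v\<^sup>\<bottom>\<close> is \<open>v\<close>
  turned by \<open>\<pi>/2\<close>. The second terms cancel under the reflection of the polygon fixing \<open>v\<close>, so the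
  velocity is \<open>N - 1\<close> times \<open>v\<close>. Hence the polygon of radius \<open>r(t)\<close> is a solution as soon as
  \<open>r r' = N - 1\<close>, that is \<open>r\<^sup>2 = r\<^sub>0\<^sup>2 + 2 (N - 1) t\<close>. Every other solution agrees with it by a Gronwall
  estimate: on a compact time interval, collision-free solutions keep a positive mutual distance.
\<close>

section \<open>Uniqueness of collision-free solutions\<close>

text \<open>Both sides square to \<open>1/|a|^2 + 1/|b|^2 - 2 (a . b)/(|a|^2 |b|^2)\<close>. This
  makes the interaction kernel Lipschitz away from collisions, with an explicit constant.\<close>

lemma norm_inversion_diff:
  fixes a b :: "'a::real_inner"
  assumes "a \<noteq> 0" "b \<noteq> 0"
  shows "norm (a /\<^sub>R (norm a)\<^sup>2 - b /\<^sub>R (norm b)\<^sup>2) = norm (a - b) / (norm a * norm b)"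
proof -
  have sq: "(norm (x - y))\<^sup>2 = (norm x)\<^sup>2 + (norm y)\<^sup>2 - 2 * (x \<bullet> y)" for x y :: 'a
    by (simp add: power2_norm_eq_inner inner_diff inner_commute)
  have "(norm (a /\<^sub>R (norm a)\<^sup>2 - b /\<^sub>R (norm b)\<^sup>2))\<^sup>2 =
      1 / (norm a)\<^sup>2 + 1 / (norm b)\<^sup>2 - 2 * (a \<bullet> b) / ((norm a)\<^sup>2 * (norm b)\<^sup>2)"
    using assms unfolding sq by (simp add: power2_eq_square divide_simps)
  also have "\<dots> = (norm (a - b) / (norm a * norm b))\<^sup>2"
    using assms unfolding power_divide power_mult_distrib sq by (simp add: field_simps)
  finally have "(norm (a /\<^sub>R (norm a)\<^sup>2 - b /\<^sub>R (norm b)\<^sup>2))\<^sup>2 =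
      (norm (a - b) / (norm a * norm b))\<^sup>2" .
  then show ?thesis
    by (rule power2_eq_imp_eq) auto
qed

text \<open>The integrating factor \<open>exp (- (C * t))\<close> turns the differential inequality
  into monotonicity.\<close>

lemma gronwall_zero:
  fixes D D' :: "real \<Rightarrow> real"
  assumes der: "\<And>t. t \<in> {0..T} \<Longrightarrow> (D has_real_derivative D' t) (at t within {0..T})"
    and bound: "\<And>t. t \<in> {0..T} \<Longrightarrow> D' t \<le> C * D t"
    and "D 0 = 0" "0 \<le> T"
  shows "D T \<le> 0"
proof -
  let ?F = "\<lambda>t. exp (- (C * t)) * D t"
  have "?F T \<le> ?F 0"
  proof (rule DERIV_nonpos_imp_decreasing_open[OF \<open>0 \<le> T\<close>])
    fix t assume t: "0 < t" "t < T"
    have "at t within {0..T} = at t"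
      using t by (intro at_within_interior) auto
    then have "(D has_real_derivative D' t) (at t)"
      using der[of t] t by auto
    then have "(?F has_real_derivative exp (- (C * t)) * (D' t - C * D t)) (at t)"
      by (auto intro!: derivative_eq_intros simp: algebra_simps)
    moreover have "exp (- (C * t)) * (D' t - C * D t) \<le> 0"
      using bound[of t] t by (auto intro!: mult_nonneg_nonpos)
    ultimately show "\<exists>y. (?F has_real_derivative y) (at t) \<and> y \<le> 0"
      by blast
  next
    have "continuous_on {0..T} D"
      using der DERIV_continuous continuous_on_eq_continuous_within by blast
    then show "continuous_on {0..T} ?F"
      by (intro continuous_intros)
  qed
  then show ?thesis
    using \<open>D 0 = 0\<close> by (simp add: mult_le_0_iff)
qed

text \<open>Inversion is applied pair by pair. The distances stay explicit in the denominators, to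
  be controlled later by compactness.\<close>

lemma vortex_velocity_diff_le:
  assumes "inj_on X {1..N}" "inj_on Y {1..N}" "j \<in> {1..N}"
  shows "norm (vortex_velocity N m X j - vortex_velocity N m Y j) \<le>
    (\<Sum>k\<in>{1..N} - {j}. 2 * \<bar>real_of_int (m j) * real_of_int (m k)\<bar> *
       ((norm (X j - Y j) + norm (X k - Y k)) / (norm (X j - X k) * norm (Y j - Y k))))"
proof -
  have diff: "vortex_velocity N m X j - vortex_velocity N m Y j =
    (\<Sum>k\<in>{1..N} - {j}. (2 * (real_of_int (m j) * real_of_int (m k))) *\<^sub>R
      ((X j - X k) /\<^sub>R (norm (X j - X k))\<^sup>2 - (Y j - Y k) /\<^sub>R (norm (Y j - Y k))\<^sup>2))"
    unfolding vortex_velocity_def scaleR_sum_right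
    by (simp only: sum_subtractf[symmetric] scaleR_right_diff_distrib scaleR_scaleR mult.assoc)
  show ?thesis
    unfolding diff
  proof (rule sum_norm_le)
    fix k assume k: "k \<in> {1..N} - {j}"
    have ne: "X j - X k \<noteq> 0" "Y j - Y k \<noteq> 0"
      using assms k by (auto dest: inj_onD)
    have "norm ((X j - X k) - (Y j - Y k)) \<le> norm (X j - Y j) + norm (X k - Y k)"
      using norm_triangle_ineq4[of "X j - Y j" "X k - Y k"] by (simp add: algebra_simps)
    then show "norm ((2 * (real_of_int (m j) * real_of_int (m k))) *\<^sub>R
        ((X j - X k) /\<^sub>R (norm (X j - X k))\<^sup>2 - (Y j - Y k) /\<^sub>R (norm (Y j - Y k))\<^sup>2)) \<le>
      2 * \<bar>real_of_int (m j) * real_of_int (m k)\<bar> *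
       ((norm (X j - Y j) + norm (X k - Y k)) / (norm (X j - X k) * norm (Y j - Y k)))"
      unfolding norm_scaleR norm_inversion_diff[OF ne]
      by (intro mult_mono divide_right_mono) (auto simp: abs_mult)
  qed
qed

lemma vortex_solution_unique:
  assumes X: "vortex_solution N m X0 X" and Y: "vortex_solution N m X0 Y"
    and "0 \<le> T" and j: "j \<in> {1..N}"
  shows "X T j = Y T j"
proof -
  define d where "d i t = X t i - Y t i" for i t
  define D where "D t = (\<Sum>i\<in>{1..N}. d i t \<bullet> d i t)" for t
  define W where "W i t = vortex_velocity N m (X t) i - vortex_velocity N m (Y t) i" for i t
  \<comment> \<open>The constant 8 is a product of three factors 2: from differentiating the square
    in \<open>D\<close>, from the vortex law, and from
    \<open>|d i| * (|d i| + |d k|) \<le> 2 * D\<close>.\<close>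
  define L where "L t = (\<Sum>i\<in>{1..N}. \<Sum>k\<in>{1..N} - {i}. 8 *
    (\<bar>real_of_int (m i) * real_of_int (m k)\<bar> / (norm (X t i - X t k) * norm (Y t i - Y t k))))" for t
  have injX: "inj_on (X t) {1..N}" and injY: "inj_on (Y t) {1..N}" if "t \<in> {0..T}" for t
    using X Y that by (auto simp: vortex_solution_def)
  have derX: "((\<lambda>s. X s i) has_vector_derivative vortex_velocity N m (X t) i) (at t within {0..T})"
    and derY: "((\<lambda>s. Y s i) has_vector_derivative vortex_velocity N m (Y t) i) (at t within {0..T})"
    if "t \<in> {0..T}" "i \<in> {1..N}" for t i
    using X Y that unfolding vortex_solution_def
    by (meson atLeastAtMost_iff has_vector_derivative_within_subset Icc_subset_Ici_iff order_refl)+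
  have contX: "continuous_on {0..T} (\<lambda>t. X t i)" and contY: "continuous_on {0..T} (\<lambda>t. Y t i)"
    if "i \<in> {1..N}" for i
    using derX derY that by (meson continuous_on_vector_derivative)+
  have neX: "X t i \<noteq> X t k" and neY: "Y t i \<noteq> Y t k"
    if "0 \<le> t" "t \<le> T" "Suc 0 \<le> i" "i \<le> N" "Suc 0 \<le> k" "k \<le> N" "k \<noteq> i" for t i k
    using that inj_onD[OF injX[of t], of i k] inj_onD[OF injY[of t], of i k] by auto
  \<comment> \<open>Absence of collisions keeps every denominator nonzero, so \<open>L\<close> is
    continuous and hence bounded on the compact interval.\<close>
  have "continuous_on {0..T} L"
    unfolding L_def
    by (intro continuous_on_sum continuous_on_mult continuous_on_divide continuous_on_norm
        continuous_on_diff continuous_on_const contX contY ballI)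
      (auto simp: neX neY)
  then have "bounded (L ` {0..T})"
    by (intro compact_imp_bounded compact_continuous_image) auto
  then obtain C where "\<forall>x\<in>L ` {0..T}. norm x \<le> C"
    unfolding bounded_iff by blast
  then have C: "L t \<le> C" if "t \<in> {0..T}" for t
    using that by (auto dest!: bspec simp: abs_le_iff)
  have D_nonneg: "0 \<le> D t" for t
    by (simp add: D_def sum_nonneg)
  have d_le: "(norm (d i t))\<^sup>2 \<le> D t" if "i \<in> {1..N}" for i t
    unfolding D_def power2_norm_eq_inner
    by (rule member_le_sum[where f = "\<lambda>i. d i t \<bullet> d i t"]) (use that in auto)
  have D_der: "(D has_real_derivative (\<Sum>i\<in>{1..N}. 2 * (d i t \<bullet> W i t))) (at t within {0..T})"
    if t: "t \<in> {0..T}" for t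
  proof -
    have dd: "(d i has_vector_derivative W i t) (at t within {0..T})" if "i \<in> {1..N}" for i
      unfolding d_def W_def by (intro has_vector_derivative_diff derX derY t that)
    have "((\<lambda>s. d i s \<bullet> d i s) has_vector_derivative 2 * (d i t \<bullet> W i t)) (at t within {0..T})"
      if "i \<in> {1..N}" for i
      using bounded_bilinear.has_vector_derivative[OF bounded_bilinear_inner dd[OF that] dd[OF that]]
      by (simp add: inner_commute)
    then show ?thesis
      unfolding has_real_derivative_iff_has_vector_derivative D_def
      by (intro has_vector_derivative_sum) auto
  qed
  have D_bound: "(\<Sum>i\<in>{1..N}. 2 * (d i t \<bullet> W i t)) \<le> C * D t" if t: "t \<in> {0..T}" for t
  proof -
    have "(\<Sum>i\<in>{1..N}. 2 * (d i t \<bullet> W i t)) \<le> L t * D t"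
      unfolding L_def sum_distrib_right
    proof (rule sum_mono)
      fix i assume i: "i \<in> {1..N}"
      have "2 * (d i t \<bullet> W i t) \<le> 2 * (norm (d i t) * norm (W i t))"
        using norm_cauchy_schwarz[of "d i t" "W i t"] by linarith
      also have "\<dots> \<le> 2 * (norm (d i t) * (\<Sum>k\<in>{1..N} - {i}. 2 * \<bar>real_of_int (m i) * real_of_int (m k)\<bar> *
       ((norm (d i t) + norm (d k t)) / (norm (X t i - X t k) * norm (Y t i - Y t k)))))"
        using vortex_velocity_diff_le[OF injX[OF t] injY[OF t] i, of m]
        by (intro mult_left_mono) (auto simp: W_def d_def)
      also have "\<dots> = (\<Sum>k\<in>{1..N} - {i}. 4 * (\<bar>real_of_int (m i) * real_of_int (m k)\<bar> /
          (norm (X t i - X t k) * norm (Y t i - Y t k))) *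
          (norm (d i t) * (norm (d i t) + norm (d k t))))"
        unfolding sum_distrib_left by (intro sum.cong refl) simp
      also have "\<dots> \<le> (\<Sum>k\<in>{1..N} - {i}. 4 * (\<bar>real_of_int (m i) * real_of_int (m k)\<bar> /
          (norm (X t i - X t k) * norm (Y t i - Y t k))) * (2 * D t))"
      proof (intro sum_mono mult_left_mono)
        fix k assume k: "k \<in> {1..N} - {i}"
        \<comment> \<open>The mixed product is at most the mean of the two squares, and each square
          is at most \<open>D t\<close>.\<close>
        have "2 * (norm (d i t) * norm (d k t)) \<le> (norm (d i t))\<^sup>2 + (norm (d k t))\<^sup>2"
          using sum_squares_bound[of "norm (d i t)" "norm (d k t)"] by (simp add: mult.assoc)
        then show "norm (d i t) * (norm (d i t) + norm (d k t)) \<le> 2 * D t"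
          using d_le[of i t] d_le[of k t] i k
          by (simp add: distrib_left power2_eq_square)
      qed auto
      finally show "2 * (d i t \<bullet> W i t) \<le> (\<Sum>k\<in>{1..N} - {i}. 8 * (\<bar>real_of_int (m i) * real_of_int (m k)\<bar> /
          (norm (X t i - X t k) * norm (Y t i - Y t k))) * D t)"
        by (simp add: algebra_simps)
    qed
    also have "\<dots> \<le> C * D t"
      by (intro mult_right_mono C t D_nonneg)
    finally show ?thesis .
  qed
  have "D 0 = 0"
    using X Y by (auto simp: D_def d_def vortex_solution_def intro!: sum.neutral)
  then have "D T \<le> 0"
    using gronwall_zero[OF D_der D_bound] \<open>0 \<le> T\<close> by blast
  then have "norm (d j T) = 0"
    using order_trans[OF d_le[OF j]] by fastforce
  then show ?thesis
    by (simp add: d_def)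
qed

section \<open>Velocity of a regular polygon\<close>

text \<open>Rotations are read in the frame of \<open>v\<close> and its quarter turn
  \<open>Q (pi / 2) *v v\<close>, in which all later computations take place.\<close>

lemma Q_mult_eq: "Q \<theta> *v v = cos \<theta> *\<^sub>R v + sin \<theta> *\<^sub>R (Q (pi / 2) *v v)"
  by (simp add: Q_def vec_eq_iff forall_2 matrix_vector_mult_def sum_2)

lemma Q_add_mult: "Q (a + b) *v v = Q a *v (Q b *v v)"
  by (simp add: Q_def vec_eq_iff forall_2 matrix_vector_mult_def sum_2 sin_add cos_add algebra_simps)

lemma norm_Q_mult: "norm (Q \<theta> *v v) = norm v"
proof -
  have "(cos \<theta> * a - sin \<theta> * b)\<^sup>2 + (sin \<theta> * a + cos \<theta> * b)\<^sup>2 = a\<^sup>2 + b\<^sup>2" for a b :: real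
    using sin_cos_squared_add[of \<theta>] by algebra
  then show ?thesis
    by (simp add: Q_def norm_vec_def L2_set_def matrix_vector_mult_def sum_2)
qed

lemma inner_Q_mult_half_pi: "v \<bullet> (Q (pi / 2) *v v) = 0"
  by (simp add: Q_def inner_vec_def matrix_vector_mult_def sum_2)

text \<open>The chord has coordinates \<open>1 - cos \<delta>\<close> and
  \<open>- sin \<delta>\<close> in this frame, so its squared length is
  \<open>2 - 2 * cos \<delta>\<close>. After division the radial coefficient is 1/2 whatever the
  angle.\<close>

lemma inversion_chord:
  assumes "norm v = 1" "cos \<delta> \<noteq> 1"
  shows "(v - Q \<delta> *v v) /\<^sub>R (norm (v - Q \<delta> *v v))\<^sup>2 =
    (1/2) *\<^sub>R v - (sin \<delta> / (2 - 2 * cos \<delta>)) *\<^sub>R (Q (pi / 2) *v v)"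
proof -
  let ?J = "Q (pi / 2) *v v"
  have chord: "v - Q \<delta> *v v = (1 - cos \<delta>) *\<^sub>R v - sin \<delta> *\<^sub>R ?J"
    by (simp add: Q_mult_eq[of \<delta>] algebra_simps)
  have "v \<bullet> v = 1" "?J \<bullet> ?J = 1"
    using assms(1) by (simp_all add: norm_Q_mult flip: power2_norm_eq_inner)
  then have "(norm (v - Q \<delta> *v v))\<^sup>2 = (1 - cos \<delta>)\<^sup>2 + (sin \<delta>)\<^sup>2"
    unfolding chord power2_norm_eq_inner
    by (simp add: inner_diff inner_Q_mult_half_pi inner_commute[of ?J v] power2_eq_square)
  also have "\<dots> = 2 - 2 * cos \<delta>"
    using sin_cos_squared_add[of \<delta>] by algebra
  finally have norm_chord: "(norm (v - Q \<delta> *v v))\<^sup>2 = 2 - 2 * cos \<delta>" .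
  have "inverse (2 - 2 * cos \<delta>) * (1 - cos \<delta>) = 1/2"
    using assms(2) by (simp add: field_simps)
  moreover have "inverse (2 - 2 * cos \<delta>) * sin \<delta> = sin \<delta> / (2 - 2 * cos \<delta>)"
    by (simp only: divide_inverse mult.commute)
  ultimately show ?thesis
    unfolding norm_chord by (simp only: chord scaleR_right_diff_distrib scaleR_scaleR)
qed

lemma polygon_vertex_relative:
  "polygon_vertex N e \<theta>0 k =
    Q (polygon_angle N k - polygon_angle N j) *v polygon_vertex N e \<theta>0 j"
  by (simp add: polygon_vertex_def flip: Q_add_mult)

text \<open>Cosine 1 would make the angle difference a multiple of \<open>2 * pi\<close>, so
  \<open>N\<close> would divide the nonzero number \<open>k - j\<close>, whose absolute value is
  below \<open>N\<close>.\<close>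

lemma cos_polygon_angle_diff_neq_1:
  assumes "j \<in> {1..N}" "k \<in> {1..N}" "k \<noteq> j"
  shows "cos (polygon_angle N k - polygon_angle N j) \<noteq> 1"
proof
  assume "cos (polygon_angle N k - polygon_angle N j) = 1"
  then obtain n :: int where "polygon_angle N k - polygon_angle N j = n * 2 * pi"
    by (auto simp: cos_one_2pi_int)
  then have "pi * (real k - real j) = pi * (n * real N)"
    using assms by (simp add: polygon_angle_def field_simps)
  then have "real_of_int (int k - int j) = real_of_int (n * int N)"
    by simp
  then have n: "int k - int j = n * int N"
    by linarith
  then have "int N dvd int k - int j"
    by simp
  then have "int N \<le> \<bar>int k - int j\<bar>"
    using assms by (intro zdvd_imp_le) auto
  then show False
    using assms by auto
qed

text \<open>The reflection fixing vertex \<open>j\<close> negates relative angles modulo a full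
  turn, so the sum equals its own negative. This also covers an antipodal vertex, which the
  reflection fixes.\<close>

lemma sum_polygon_odd_periodic:
  fixes h :: "real \<Rightarrow> real"
  assumes odd: "\<And>x. h (- x) = - h x" and per: "\<And>x. h (x + 2 * pi) = h x"
    and j: "j \<in> {1..N}"
  shows "(\<Sum>k\<in>{1..N} - {j}. h (polygon_angle N k - polygon_angle N j)) = 0"
    (is "?S = 0")
proof -
  \<comment> \<open>The reflection \<open>k \<mapsto> 2j - k\<close> modulo \<open>N\<close>, with representatives in \<open>{1..N}\<close>.\<close>
  define \<sigma> where "\<sigma> k = (if 2 * j \<le> k then 2 * j + N - k
    else if k + N < 2 * j then 2 * j - k - N else 2 * j - k)" for k
  have h: "h (polygon_angle N (\<sigma> k) - polygon_angle N j) =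
      - h (polygon_angle N k - polygon_angle N j)" if "k \<in> {1..N} - {j}" for k
  proof -
    let ?x = "polygon_angle N k - polygon_angle N j"
    have "N > 0" using j by auto
    consider "2 * j \<le> k" | "2 * j > k" "k + N < 2 * j" | "2 * j > k" "k + N \<ge> 2 * j"
      by linarith
    \<comment> \<open>Shifting an index by \<open>N\<close> shifts its angle by
      \<open>2 * pi\<close>; the three branches of \<open>\<sigma>\<close> give the three listed
      values.\<close>
    then have "polygon_angle N (\<sigma> k) - polygon_angle N j \<in> {- ?x, - ?x + 2 * pi, - ?x - 2 * pi}"
      using that \<open>N > 0\<close>
      by cases (auto simp: \<sigma>_def polygon_angle_def of_nat_diff field_simps)
    moreover have "h (- ?x - 2 * pi) = h (- ?x)"
      using per[of "- ?x - 2 * pi"] by simp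
    ultimately show ?thesis
      using per[of "- ?x"] odd[of ?x] by (elim insertE emptyE) (simp_all only:)
  qed
  \<comment> \<open>\<open>\<sigma>\<close> is an involution of \<open>{1..N} - {j}\<close>, hence
    serves as its own inverse.\<close>
  have "?S = (\<Sum>k\<in>{1..N} - {j}. h (polygon_angle N (\<sigma> k) - polygon_angle N j))"
    by (rule sum.reindex_bij_witness[of _ \<sigma> \<sigma>]) (use j in \<open>auto simp: \<sigma>_def split: if_splits\<close>)
  also have "\<dots> = - ?S"
    using h by (simp add: sum_negf)
  finally show ?thesis
    by simp
qed

lemma vortex_velocity_polygon:
  assumes sign: "(\<forall>j\<in>{1..N}. m j = 1) \<or> (\<forall>j\<in>{1..N}. m j = -1)"
    and "norm e = 1" and j: "j \<in> {1..N}" and "r > 0"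
    and X: "\<And>k. k \<in> {1..N} \<Longrightarrow> X k = x0 + r *\<^sub>R polygon_vertex N e \<theta>0 k"
  shows "vortex_velocity N m X j = ((real N - 1) / r) *\<^sub>R polygon_vertex N e \<theta>0 j"
proof -
  let ?v = "polygon_vertex N e \<theta>0"
  let ?J = "Q (pi / 2) *v ?v j"
  define \<delta> where "\<delta> k = polygon_angle N k - polygon_angle N j" for k
  define h where "h x = sin x / (2 - 2 * cos x)" for x :: real
  \<comment> \<open>Equal winding numbers allow \<open>m j\<close> in place of \<open>m k\<close>;
    together with the outer factor \<open>m j\<close> it gives 1 for either sign. Inversion is
    homogeneous of degree -1, whence the factor \<open>1 / r\<close>.\<close>
  have summand: "real_of_int (m k) *\<^sub>R ((X j - X k) /\<^sub>R (norm (X j - X k))\<^sup>2) =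
      (real_of_int (m j) / r) *\<^sub>R ((1/2) *\<^sub>R ?v j - h (\<delta> k) *\<^sub>R ?J)"
    if k: "k \<in> {1..N} - {j}" for k
  proof -
    have "X j - X k = r *\<^sub>R (?v j - Q (\<delta> k) *v ?v j)"
      using X j k polygon_vertex_relative[of N e \<theta>0 k j] by (simp add: \<delta>_def algebra_simps)
    then have "(X j - X k) /\<^sub>R (norm (X j - X k))\<^sup>2 =
        (1 / r) *\<^sub>R ((?v j - Q (\<delta> k) *v ?v j) /\<^sub>R (norm (?v j - Q (\<delta> k) *v ?v j))\<^sup>2)"
      using \<open>r > 0\<close> by (simp add: power_mult_distrib power2_eq_square divide_inverse)
    also have "\<dots> = (1 / r) *\<^sub>R ((1/2) *\<^sub>R ?v j - h (\<delta> k) *\<^sub>R ?J)"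
      using inversion_chord[of "?v j" "\<delta> k"] cos_polygon_angle_diff_neq_1[OF j, of k] k \<open>norm e = 1\<close>
      by (simp add: \<delta>_def h_def polygon_vertex_def norm_Q_mult)
    finally show ?thesis
      using sign j k by auto
  qed
  have sum_h: "(\<Sum>k\<in>{1..N} - {j}. h (\<delta> k)) = 0"
    unfolding \<delta>_def by (rule sum_polygon_odd_periodic[OF _ _ j]) (auto simp: h_def)
  have "vortex_velocity N m X j = (2 * real_of_int (m j)) *\<^sub>R
      (\<Sum>k\<in>{1..N} - {j}. (real_of_int (m j) / r) *\<^sub>R ((1/2) *\<^sub>R ?v j - h (\<delta> k) *\<^sub>R ?J))"
    unfolding vortex_velocity_def by (intro arg_cong[where f = "scaleR _"] sum.cong refl summand)
  also have "\<dots> = (2 * real_of_int (m j) * (real_of_int (m j) / r)) *\<^sub>R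
        ((\<Sum>k\<in>{1..N} - {j}. (1/2) *\<^sub>R ?v j) - (\<Sum>k\<in>{1..N} - {j}. h (\<delta> k)) *\<^sub>R ?J)"
    by (simp only: sum_subtractf scaleR_scaleR flip: scaleR_sum_right scaleR_sum_left)
  \<comment> \<open>The prefactor 2 cancels the radial coefficient 1/2, and \<open>N - 1\<close>
    equal terms remain.\<close>
  also have "\<dots> = ((real N - 1) / r) *\<^sub>R ?v j"
    unfolding sum_h sum_constant_scaleR using sign j by (auto simp: of_nat_diff)
  finally show ?thesis .
qed

section \<open>The explicit expanding polygon\<close>

lemma vortex_solution_polygon:
  assumes sign: "(\<forall>j\<in>{1..N}. m j = 1) \<or> (\<forall>j\<in>{1..N}. m j = -1)"
    and "N > 0" "norm e = 1" "r > 0"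
    and X0: "\<And>j. j \<in> {1..N} \<Longrightarrow> X0 j = x0 + r *\<^sub>R polygon_vertex N e \<theta>0 j"
  shows "vortex_solution N m X0
    (\<lambda>t j. x0 + sqrt (r\<^sup>2 + 2 * (real N - 1) * t) *\<^sub>R polygon_vertex N e \<theta>0 j)"
proof -
  let ?v = "polygon_vertex N e \<theta>0"
  let ?\<rho> = "\<lambda>t. sqrt (r\<^sup>2 + 2 * (real N - 1) * t)"
  \<comment> \<open>Strict positivity, including at time 0, keeps the square root
    differentiable.\<close>
  have pos: "r\<^sup>2 + 2 * (real N - 1) * t > 0" if "t \<ge> 0" for t
    using that \<open>N > 0\<close> \<open>r > 0\<close> by (intro add_pos_nonneg mult_nonneg_nonneg) auto
  have "((\<lambda>s. x0 + ?\<rho> s *\<^sub>R ?v j) has_vector_derivative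
      vortex_velocity N m (\<lambda>j. x0 + ?\<rho> t *\<^sub>R ?v j) j) (at t within {0..})"
    if "t \<ge> 0" "j \<in> {1..N}" for t j
  proof -
    have "(?\<rho> has_real_derivative (real N - 1) / ?\<rho> t) (at t within {0..})"
    proof -
      have "((\<lambda>t. r\<^sup>2 + 2 * (real N - 1) * t) has_real_derivative 2 * (real N - 1)) (at t within {0..})"
        by (auto intro!: derivative_eq_intros)
      note chain = DERIV_chain2[where f = sqrt and g = "\<lambda>t. r\<^sup>2 + 2 * (real N - 1) * t",
          OF DERIV_real_sqrt[OF pos[OF that(1)]] this]
      have "inverse s / 2 * (2 * c) = c / s" for s c :: real
        by (simp add: field_simps)
      then show ?thesis
        by (rule DERIV_cong[OF chain])
    qed
    then have "((\<lambda>s. x0 + ?\<rho> s *\<^sub>R ?v j) has_vector_derivative ((real N - 1) / ?\<rho> t) *\<^sub>R ?v j)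
        (at t within {0..})"
      using has_vector_derivative_add[OF has_vector_derivative_const
          has_vector_derivative_scaleR[OF _ has_vector_derivative_const]] by fastforce
    then show ?thesis
      using vortex_velocity_polygon[OF sign \<open>norm e = 1\<close> that(2), of "?\<rho> t" _ x0 \<theta>0] pos[OF that(1)]
      by simp
  qed
  moreover have "inj_on (\<lambda>j. x0 + ?\<rho> t *\<^sub>R ?v j) {1..N}" if "t \<ge> 0" for t
  proof (rule inj_onI, rule ccontr)
    fix j k assume jk: "j \<in> {1..N}" "k \<in> {1..N}" "x0 + ?\<rho> t *\<^sub>R ?v j = x0 + ?\<rho> t *\<^sub>R ?v k" "j \<noteq> k"
    let ?\<delta> = "polygon_angle N k - polygon_angle N j"
    have v: "norm (?v j) = 1"
      using \<open>norm e = 1\<close> by (simp add: polygon_vertex_def norm_Q_mult)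
    have "?v k = ?v j"
      using jk pos[OF that] by simp
    then have "Q ?\<delta> *v ?v j = ?v j"
      using polygon_vertex_relative by metis
    moreover have "cos ?\<delta> \<noteq> 1"
      using jk by (intro cos_polygon_angle_diff_neq_1) auto
    \<comment> \<open>If two vertices coincided, the inverted chord would be zero, yet its inner
      product with the unit vector \<open>?v j\<close> is 1/2.\<close>
    ultimately have "(1/2) *\<^sub>R ?v j - (sin ?\<delta> / (2 - 2 * cos ?\<delta>)) *\<^sub>R (Q (pi / 2) *v ?v j) = 0"
      using inversion_chord[OF v] by (metis diff_self scaleR_zero_right)
    then have "?v j \<bullet> ((1/2) *\<^sub>R ?v j - (sin ?\<delta> / (2 - 2 * cos ?\<delta>)) *\<^sub>R (Q (pi / 2) *v ?v j)) = 0"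
      by (simp only: inner_zero_right)
    moreover have "?v j \<bullet> ?v j = 1"
      using v by (simp flip: power2_norm_eq_inner)
    ultimately show False
      by (simp add: inner_diff inner_Q_mult_half_pi)
  qed
  ultimately show ?thesis
    using X0 \<open>r > 0\<close> by (simp add: vortex_solution_def)
qed

theorem lemma2p3:
  fixes N :: nat and m :: "nat \<Rightarrow> int"
    and e x0 :: "real^2" and \<theta>0 :: real
    and X0 :: "nat \<Rightarrow> real^2"
  assumes "N \<ge> 2"
    and "(\<forall>j\<in>{1..N}. m j = 1) \<or> (\<forall>j\<in>{1..N}. m j = -1)"
    and "norm e = 1"
    and "0 \<le> \<theta>0" and "\<theta>0 < 2 * pi"
    and "X0 \<in> regular_polygons N e x0 \<theta>0"
  shows "(\<exists>X. vortex_solution N m X0 X) \<and>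
         (\<forall>X. vortex_solution N m X0 X \<longrightarrow> (\<forall>t\<ge>0. X t \<in> regular_polygons N e x0 \<theta>0))"
proof -
  obtain r where r: "r > 0" "\<And>j. j \<in> {1..N} \<Longrightarrow> X0 j = x0 + r *\<^sub>R polygon_vertex N e \<theta>0 j"
    using assms(6) by (auto simp: regular_polygons_def)
  let ?\<rho> = "\<lambda>t. sqrt (r\<^sup>2 + 2 * (real N - 1) * t)"
  \<comment> \<open>This solution gives existence and is the one with which every other solution is
    compared.\<close>
  have sol: "vortex_solution N m X0 (\<lambda>t j. x0 + ?\<rho> t *\<^sub>R polygon_vertex N e \<theta>0 j)"
    using assms r by (intro vortex_solution_polygon) auto
  have "X t \<in> regular_polygons N e x0 \<theta>0" if X: "vortex_solution N m X0 X" and "t \<ge> 0" for X t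
  proof -
    \<comment> \<open>\<open>?\<rho> t\<close> is the witness for the radius. Uniqueness identifies
      \<open>X t\<close> with the explicit solution at the indices \<open>1\<close> to
      \<open>N\<close>, the only ones that \<open>regular_polygons\<close> constrains.\<close>
    have "?\<rho> t > 0"
      using \<open>N \<ge> 2\<close> \<open>r > 0\<close> \<open>t \<ge> 0\<close> by (auto intro!: add_pos_nonneg)
    then show ?thesis
      unfolding regular_polygons_def using vortex_solution_unique[OF X sol \<open>t \<ge> 0\<close>] by blast
  qed
  then show ?thesis
    using sol by blast
qed

end
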